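(* Let $\{W_k(a_0,\dots,a_{n-1};p_0,\dots,p_{n-1})\}$ be an $n$th-order linear recurrence, defined by $W_{k+n}=\sum_{i=0}^{n-1}p_iW_{k+n-1-i}$ with the initial values $W_i=a_i$ $(0\le i\le n-1)$. To compute the $N$th term of this $n$th-order linear recurrence by the scheme described in the context, we need $\frac{n(n+1)}{2}\log_2 N$ multiplications, in the complexity model in which multiplications involving the $p_i$ are similar to additions (and so are not counted).
   Context: Let $\{X_k\}$ be the sequence satisfying the same recurrence as $\{W_k\}$ with $X_0=\dots=X_{n-2}=0$, $X_{n-1}=1$. Put $e=n\bmod 2$ and $v=n/2-1$. Empty sums are $0$; terms with coefficient $e$ (resp. $1-e$) are absent when $n$ is even (resp. odd). The scheme uses the formulas $$X_{2k}=e\,X_{k+(n-1)/2}^2+\sum_{i=0}^{\lfloor v\rfloor}X_{k+\lfloor v\rfloor-i}\Bigl(2X_{k+\lceil v\rceil+1+i}-p_{2i+e}X_{k+\lfloor v\rfloor-i}-2\sum_{j=0}^{2i-1+e}p_jX_{k+\lceil v\rceil+i-j}\Bigr),$$ $$X_{2k+1}=p_{n-1}X_k^2+(1-e)X_{k+n/2}^2+\sum_{i=0}^{\lceil v\rceil-1}X_{k+\lceil v\rceil-i}\Bigl(2X_{k+\lfloor v\rfloor+2+i}-p_{2i+1-e}X_{k+\lceil v\rceil-i}-2\sum_{j=0}^{2i-e}p_jX_{k+\lfloor v\rfloor+1+i-j}\Bigr).$$ Scheme. (i) Repeatedly replacing $k$ by $k+1$ in these two formulas and using $X_{k+n}=\sum_{i=0}^{n-1}p_iX_{k+n-1-i}$,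 without removing brackets, obtain formulas for $X_{2k+i}$ $(0\le i\le n)$ in terms of $X_k,\dots,X_{k+n-1}$. These give the rules of transition from $X_{k+i}$ $(0\le i\le n-1)$ to $X_{2k+i}$ $(0\le i\le n-1)$ and to $X_{2k+1+i}$ $(0\le i\le n-1)$. (ii) Write $N=\sum_{i=0}^{m-1}b_i2^i$ in binary with $b_{m-1}=1$, start with $(X_1,\dots,X_n)$ (so $k=1$), and for $j=m-2,\dots,0$ pass from $k$ to $2k$ if $b_j=0$ and from $k$ to $2k+1$ if $b_j=1$; this yields $X_{N+i}$ $(0\le i\le n-1)$. (iii) Obtain $W_N$ from $$W_k=\sum_{j=0}^{n-1}\Bigl(a_{n-1-j}-\sum_{i=0}^{n-j-2}a_{n-j-2-i}\,p_i\Bigr)X_{k+j}$$ with $k=N$; this last formula is regarded as containing no "big" multiplications. Each squaring of a term of $\{X_k\}$, and each product of such a term with a bracketed expression, counts as one multiplication. *)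

theory Defs
  imports Complex_Main
begin

text \<open>
  The recurrence \<open>W\<^sub>k\<^sub>+\<^sub>n = (\<Sum>i<n. p\<^sub>i W\<^sub>k\<^sub>+\<^sub>n\<^sub>-\<^sub>1\<^sub>-\<^sub>i)\<close> with initial values \<open>a\<^sub>0, \<dots>, a\<^sub>n\<^sub>-\<^sub>1\<close>.
\<close>

function lin_rec :: "nat \<Rightarrow> (nat \<Rightarrow> 'a::comm_ring_1) \<Rightarrow> (nat \<Rightarrow> 'a) \<Rightarrow> nat \<Rightarrow> 'a" where
  "lin_rec n a p k = (if k < n then a k else (\<Sum>i<n. p i * lin_rec n a p (k - 1 - i)))"
  by pat_completeness auto
termination
  by (relation "measure (\<lambda>(n, a, p, k). k)") auto

declare lin_rec.simps [simp del]

definition X_seq :: "nat \<Rightarrow> (nat \<Rightarrow> 'a::comm_ring_1) \<Rightarrow> nat \<Rightarrow> 'a" where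
  "X_seq n p = lin_rec n (\<lambda>i. if i = n - 1 then 1 else 0) p"

text \<open>
  Formulas are kept as syntax trees, so that multiplications can be counted without
  removing brackets. \<open>Term d\<close> stands for \<open>X\<^sub>k\<^sub>+\<^sub>d\<close>, with \<open>k\<close> left symbolic. \<open>Scale c\<close> is
  multiplication by a constant built from the \<open>p\<^sub>i\<close>, the \<open>a\<^sub>i\<close> and integers; it is
  free of charge, as are additions and subtractions. \<open>Square\<close> and \<open>Mult\<close> are the
  multiplications that count.
\<close>

datatype 'a form =
    Zero
  | Term nat
  | Plus "'a form" "'a form"
  | Minus "'a form" "'a form"
  | Scale 'a "'a form"
  | Square "'a form"
  | Mult "'a form" "'a form"

primrec eval_form :: "'a::comm_ring_1 list \<Rightarrow> 'a form \<Rightarrow> 'a" where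
  "eval_form xs Zero = 0"
| "eval_form xs (Term d) = xs ! d"
| "eval_form xs (Plus s t) = eval_form xs s + eval_form xs t"
| "eval_form xs (Minus s t) = eval_form xs s - eval_form xs t"
| "eval_form xs (Scale c t) = c * eval_form xs t"
| "eval_form xs (Square t) = (eval_form xs t)\<^sup>2"
| "eval_form xs (Mult s t) = eval_form xs s * eval_form xs t"

primrec mults :: "'a form \<Rightarrow> nat" where
  "mults Zero = 0"
| "mults (Term d) = 0"
| "mults (Plus s t) = mults s + mults t"
| "mults (Minus s t) = mults s + mults t"
| "mults (Scale c t) = mults t"
| "mults (Square t) = mults t + 1"
| "mults (Mult s t) = mults s + mults t + 1"

primrec subst_form :: "(nat \<Rightarrow> 'a form) \<Rightarrow> 'a form \<Rightarrow> 'a form" where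
  "subst_form \<sigma> Zero = Zero"
| "subst_form \<sigma> (Term d) = \<sigma> d"
| "subst_form \<sigma> (Plus s t) = Plus (subst_form \<sigma> s) (subst_form \<sigma> t)"
| "subst_form \<sigma> (Minus s t) = Minus (subst_form \<sigma> s) (subst_form \<sigma> t)"
| "subst_form \<sigma> (Scale c t) = Scale c (subst_form \<sigma> t)"
| "subst_form \<sigma> (Square t) = Square (subst_form \<sigma> t)"
| "subst_form \<sigma> (Mult s t) = Mult (subst_form \<sigma> s) (subst_form \<sigma> t)"

text \<open>\<open>Sum_form m f\<close> is the formal sum of \<open>f 0, \<dots>, f (m - 1)\<close>.\<close>

primrec Sum_form :: "nat \<Rightarrow> (nat \<Rightarrow> 'a form) \<Rightarrow> 'a form" where
  "Sum_form 0 f = Zero"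
| "Sum_form (Suc m) f = Plus (Sum_form m f) (f m)"

text \<open>
  The formulas for \<open>X\<^sub>2\<^sub>k\<close> and \<open>X\<^sub>2\<^sub>k\<^sub>+\<^sub>1\<close>. With \<open>v = n/2 - 1\<close>, the numbers \<open>lo = \<lfloor>v\<rfloor> + 1\<close>
  and \<open>hi = \<lceil>v\<rceil> + 1\<close> are used instead of \<open>\<lfloor>v\<rfloor>\<close> and \<open>\<lceil>v\<rceil>\<close>, because \<open>\<lfloor>v\<rfloor> = -1\<close> for \<open>n = 1\<close>;
  thus \<open>i = 0, \<dots>, \<lfloor>v\<rfloor>\<close> becomes \<open>i < lo\<close>, and \<open>i = 0, \<dots>, \<lceil>v\<rceil> - 1\<close> becomes \<open>i < hi - 1\<close>.
  For \<open>n \<ge> 1\<close> and \<open>i\<close>, \<open>j\<close> in range, no subtraction below truncates and all offsets are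
  less than \<open>n\<close>.
\<close>

definition even_form :: "nat \<Rightarrow> (nat \<Rightarrow> 'a::comm_ring_1) \<Rightarrow> 'a form" where
  "even_form n p =
    (let e = n mod 2; lo = n div 2; hi = (n + 1) div 2 in
      Plus (if e = 1 then Square (Term ((n - 1) div 2)) else Zero)
        (Sum_form lo (\<lambda>i.
          Mult (Term (lo - 1 - i))
            (Minus
              (Minus (Scale 2 (Term (hi + i)))
                (Scale (p (2 * i + e)) (Term (lo - 1 - i))))
              (Scale 2 (Sum_form (2 * i + e) (\<lambda>j. Scale (p j) (Term (hi - 1 + i - j)))))))))"

definition odd_form :: "nat \<Rightarrow> (nat \<Rightarrow> 'a::comm_ring_1) \<Rightarrow> 'a form" where
  "odd_form n p =
    (let e = n mod 2; lo = n div 2; hi = (n + 1) div 2 in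
      Plus (Plus (Scale (p (n - 1)) (Square (Term 0)))
          (if e = 0 then Square (Term (n div 2)) else Zero))
        (Sum_form (hi - 1) (\<lambda>i.
          Mult (Term (hi - 1 - i))
            (Minus
              (Minus (Scale 2 (Term (lo + 1 + i)))
                (Scale (p (2 * i + 1 - e)) (Term (hi - 1 - i))))
              (Scale 2 (Sum_form (2 * i + 1 - e) (\<lambda>j. Scale (p j) (Term (lo + i - j)))))))))"

text \<open>
  Replacing \<open>k\<close> by \<open>k + 1\<close>: \<open>X\<^sub>k\<^sub>+\<^sub>d\<close> becomes \<open>X\<^sub>k\<^sub>+\<^sub>d\<^sub>+\<^sub>1\<close>, except that \<open>X\<^sub>k\<^sub>+\<^sub>n\<close> is written
  by the recurrence in terms of \<open>X\<^sub>k, \<dots>, X\<^sub>k\<^sub>+\<^sub>n\<^sub>-\<^sub>1\<close>.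
\<close>

definition shift_term :: "nat \<Rightarrow> (nat \<Rightarrow> 'a::comm_ring_1) \<Rightarrow> nat \<Rightarrow> 'a form" where
  "shift_term n p d =
    (if d + 1 < n then Term (d + 1) else Sum_form n (\<lambda>i. Scale (p i) (Term (n - 1 - i))))"

text \<open>\<open>trans_form n p i\<close> is the formula for \<open>X\<^sub>2\<^sub>k\<^sub>+\<^sub>i\<close> in terms of \<open>X\<^sub>k, \<dots>, X\<^sub>k\<^sub>+\<^sub>n\<^sub>-\<^sub>1\<close>.\<close>

fun trans_form :: "nat \<Rightarrow> (nat \<Rightarrow> 'a::comm_ring_1) \<Rightarrow> nat \<Rightarrow> 'a form" where
  "trans_form n p 0 = even_form n p"
| "trans_form n p (Suc 0) = odd_form n p"
| "trans_form n p (Suc (Suc i)) = subst_form (shift_term n p) (trans_form n p i)"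

text \<open>
  The rules of transition from \<open>X\<^sub>k\<^sub>+\<^sub>i\<close> to \<open>X\<^sub>2\<^sub>k\<^sub>+\<^sub>i\<close> (digit 0) and to \<open>X\<^sub>2\<^sub>k\<^sub>+\<^sub>1\<^sub>+\<^sub>i\<close> (digit 1),
  \<open>0 \<le> i \<le> n - 1\<close>.
\<close>

definition transition :: "nat \<Rightarrow> (nat \<Rightarrow> 'a::comm_ring_1) \<Rightarrow> bool \<Rightarrow> 'a form list" where
  "transition n p b = map (\<lambda>i. trans_form n p (i + of_bool b)) [0..<n]"

definition final_form ::
  "nat \<Rightarrow> (nat \<Rightarrow> 'a::comm_ring_1) \<Rightarrow> (nat \<Rightarrow> 'a) \<Rightarrow> 'a form" where
  "final_form n a p =
    Sum_form n (\<lambda>j. Scale (a (n - 1 - j) - (\<Sum>i<n - j - 1. a (n - j - 2 - i) * p i)) (Term j))"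

text \<open>
  A state consists of the current list \<open>[X\<^sub>k, \<dots>, X\<^sub>k\<^sub>+\<^sub>n\<^sub>-\<^sub>1]\<close> and the number of
  multiplications performed so far.
\<close>

definition scheme_step ::
  "nat \<Rightarrow> (nat \<Rightarrow> 'a::comm_ring_1) \<Rightarrow> bool \<Rightarrow> 'a list \<times> nat \<Rightarrow> 'a list \<times> nat" where
  "scheme_step n p b s =
    (map (eval_form (fst s)) (transition n p b),
     snd s + sum_list (map mults (transition n p b)))"

text \<open>
  The binary digits of \<open>N = (\<Sum>i<m. b\<^sub>i 2\<^sup>i)\<close> are \<open>b\<^sub>i = bit N i\<close>; for \<open>N \<ge> 1\<close> the condition
  \<open>b\<^sub>m\<^sub>-\<^sub>1 = 1\<close> says that \<open>m\<close> is the least number with \<open>N < 2\<^sup>m\<close>.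
\<close>

definition num_digits :: "nat \<Rightarrow> nat" where
  "num_digits N = (LEAST m. N < 2 ^ m)"

text \<open>The digits are processed in the order \<open>j = m - 2, \<dots>, 0\<close>.\<close>

definition scheme_loop ::
  "nat \<Rightarrow> (nat \<Rightarrow> 'a::comm_ring_1) \<Rightarrow> nat \<Rightarrow> 'a list \<times> nat" where
  "scheme_loop n p N =
    foldl (\<lambda>s j. scheme_step n p (bit N j) s)
      (map (X_seq n p) [1..<n + 1], 0)
      (rev [0..<num_digits N - 1])"

text \<open>The result is the pair of the computed value and the number of multiplications.\<close>

definition scheme ::
  "nat \<Rightarrow> (nat \<Rightarrow> 'a::comm_ring_1) \<Rightarrow> (nat \<Rightarrow> 'a) \<Rightarrow> nat \<Rightarrow> 'a \<times> nat" where
  "scheme n a p N =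
    (let s = scheme_loop n p N
     in (eval_form (fst s) (final_form n a p), snd s + mults (final_form n a p)))"

end

theory Submission
  imports Defs
begin

text \<open>
  Put \<open>q\<^sub>0 = 1\<close> and \<open>q\<^sub>i\<^sub>+\<^sub>1 = - p\<^sub>i\<close>, so that the recurrence reads \<open>(\<Sum>b\<le>n. q\<^sub>n\<^sub>-\<^sub>b W\<^sub>k\<^sub>+\<^sub>b) = 0\<close>, and let
  \<open>B(k, m) = (\<Sum>a + b < n. q\<^sub>n\<^sub>-\<^sub>1\<^sub>-\<^sub>a\<^sub>-\<^sub>b W\<^sub>k\<^sub>+\<^sub>a X\<^sub>m\<^sub>+\<^sub>b)\<close>.
  Splitting off the terms with \<open>a = 0\<close>, respectively \<open>b = 0\<close>, and applying the recurrence gives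
  \<open>B(k, m + 1) = p\<^sub>n\<^sub>-\<^sub>1 W\<^sub>k X\<^sub>m + (\<Sum>a + b < n - 1. q\<^sub>n\<^sub>-\<^sub>2\<^sub>-\<^sub>a\<^sub>-\<^sub>b W\<^sub>k\<^sub>+\<^sub>1\<^sub>+\<^sub>a X\<^sub>m\<^sub>+\<^sub>1\<^sub>+\<^sub>b) = B(k + 1, m)\<close>,
  hence \<open>B(k, m) = B(k + m, 0) = W\<^sub>k\<^sub>+\<^sub>m\<close>. The case \<open>k = 0\<close> is the final formula of the scheme.
  For \<open>W = X\<close>, the cases \<open>B(k, k)\<close> and \<open>B(k, k + 1)\<close> are the doubling formulas, once the
  symmetric double sums are folded to \<open>a \<le> b\<close>.

  Substitution of multiplication-free formulas does not change the number of multiplications,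
  so each \<open>X\<^sub>2\<^sub>k\<^sub>+\<^sub>i\<close> costs as much as \<open>X\<^sub>2\<^sub>k\<close> or \<open>X\<^sub>2\<^sub>k\<^sub>+\<^sub>1\<close>, according to the parity of \<open>i\<close>; either
  transition costs \<open>n (n + 1) / 2\<close> in total, and there are \<open>\<lfloor>log 2 N\<rfloor>\<close> of them.
\<close>

section \<open>The bilinear addition formula\<close>

definition rec_coeff :: "(nat \<Rightarrow> 'a::comm_ring_1) \<Rightarrow> nat \<Rightarrow> 'a" where
  "rec_coeff p i = (case i of 0 \<Rightarrow> 1 | Suc j \<Rightarrow> - p j)"

lemma rec_coeff_simps [simp]:
  "rec_coeff p 0 = 1"
  "rec_coeff p (Suc i) = - p i"
  by (simp_all add: rec_coeff_def)

text \<open>The form B of the overview, with the size n detached from the order of the recurrence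
  and with arbitrary arguments, so that peeling off an edge leaves the same form of smaller
  size.\<close>

definition tri_form ::
  "(nat \<Rightarrow> 'a::comm_ring_1) \<Rightarrow> nat \<Rightarrow> (nat \<Rightarrow> 'a) \<Rightarrow> (nat \<Rightarrow> 'a) \<Rightarrow> 'a" where
  "tri_form p n f g = (\<Sum>a<n. \<Sum>b<n - a. rec_coeff p (n - 1 - a - b) * f a * g b)"

lemma tri_form_0 [simp]: "tri_form p 0 f g = 0"
  by (simp add: tri_form_def)

lemma tri_form_commute: "tri_form p n f g = tri_form p n g f"
proof -
  have "tri_form p n f g =
      (\<Sum>(a, b)\<in>(SIGMA a:{..<n}. {..<n - a}). rec_coeff p (n - 1 - a - b) * f a * g b)"
    by (simp add: tri_form_def sum.Sigma)
  also have "\<dots> =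
      (\<Sum>(b, a)\<in>(SIGMA b:{..<n}. {..<n - b}). rec_coeff p (n - 1 - b - a) * g b * f a)"
    by (rule sum.reindex_bij_witness[where i = prod.swap and j = prod.swap])
      (auto simp: add.commute mult_ac)
  also have "\<dots> = tri_form p n g f"
    by (simp add: tri_form_def sum.Sigma)
  finally show ?thesis .
qed

lemma tri_form_Suc:
  "tri_form p (Suc n) f g =
    f 0 * (\<Sum>b\<le>n. rec_coeff p (n - b) * g b) + tri_form p n (\<lambda>a. f (Suc a)) g"
  unfolding tri_form_def
  by (subst sum.lessThan_Suc_shift) (simp add: sum_distrib_left lessThan_Suc_atMost mult_ac)

lemma tri_form_Suc':
  "tri_form p (Suc n) f g =
    g 0 * (\<Sum>a\<le>n. rec_coeff p (n - a) * f a) + tri_form p n f (\<lambda>b. g (Suc b))"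
  using tri_form_Suc[of p n g f] tri_form_commute[of p] by metis

lemma sum_rec_coeff:
  "(\<Sum>b\<le>n. rec_coeff p (n - b) * f b) = f n - (\<Sum>i<n. p i * f (n - 1 - i))"
proof -
  have "(\<Sum>b<n. rec_coeff p (n - b) * f b) = (\<Sum>i<n. rec_coeff p (Suc i) * f (n - Suc i))"
    by (subst sum.nat_diff_reindex[symmetric]) simp
  then show ?thesis
    by (simp flip: lessThan_Suc_atMost add: sum_negf)
qed

definition lin_recurrent :: "nat \<Rightarrow> (nat \<Rightarrow> 'a::comm_ring_1) \<Rightarrow> (nat \<Rightarrow> 'a) \<Rightarrow> bool" where
  "lin_recurrent n p w \<longleftrightarrow> (\<forall>k. w (k + n) = (\<Sum>i<n. p i * w (k + n - 1 - i)))"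

lemma lin_recurrent_lin_rec: "lin_recurrent n p (lin_rec n a p)"
  unfolding lin_recurrent_def by (subst lin_rec.simps) simp

lemma lin_recurrent_X_seq: "lin_recurrent n p (X_seq n p)"
  unfolding X_seq_def by (rule lin_recurrent_lin_rec)

lemma lin_recurrent_tail:
  assumes "lin_recurrent (Suc n) p w"
  shows "(\<Sum>b\<le>n. rec_coeff p (n - b) * w (k + Suc b)) = p n * w k"
proof -
  have "w (k + Suc n) = (\<Sum>i<n. p i * w (k + Suc (n - 1 - i))) + p n * w k"
    using assms by (auto simp: lin_recurrent_def Suc_diff_Suc intro!: sum.cong)
  then show ?thesis
    by (simp add: sum_rec_coeff)
qed

text \<open>The recurrence for \<open>u\<close> collapses the row a = 0 to a single product. That
  product and the remaining triangle are symmetric in (w, k) and (u, m), which is what makes the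
  swap of shifts possible.\<close>

lemma tri_form_shift:
  assumes "lin_recurrent (Suc n) p u"
  shows "tri_form p (Suc n) (\<lambda>a. w (k + a)) (\<lambda>b. u (Suc m + b)) =
    p n * w k * u m + tri_form p n (\<lambda>a. w (Suc k + a)) (\<lambda>b. u (Suc m + b))"
  using lin_recurrent_tail[OF assms, of m] by (simp add: tri_form_Suc mult_ac)

lemma tri_form_swap_shift:
  assumes "lin_recurrent n p w" and "lin_recurrent n p u"
  shows "tri_form p n (\<lambda>a. w (k + a)) (\<lambda>b. u (Suc m + b)) =
    tri_form p n (\<lambda>a. w (Suc k + a)) (\<lambda>b. u (m + b))"
proof (cases n)
  case (Suc l)
  have "tri_form p n (\<lambda>a. w (k + a)) (\<lambda>b. u (Suc m + b)) =
      p l * w k * u m + tri_form p l (\<lambda>a. w (Suc k + a)) (\<lambda>b. u (Suc m + b))"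
    using tri_form_shift[of l p u w k m] assms(2) unfolding Suc by blast
  also have "\<dots> = p l * u m * w k + tri_form p l (\<lambda>b. u (Suc m + b)) (\<lambda>a. w (Suc k + a))"
    by (subst tri_form_commute) (simp only: mult.assoc mult.commute[of "w k"])
  also have "\<dots> = tri_form p n (\<lambda>b. u (m + b)) (\<lambda>a. w (Suc k + a))"
    using tri_form_shift[of l p w u m k] assms(1) unfolding Suc by metis
  also have "\<dots> = tri_form p n (\<lambda>a. w (Suc k + a)) (\<lambda>b. u (m + b))"
    by (rule tri_form_commute)
  finally show ?thesis .
qed simp

lemma X_seq_initial: "i < n \<Longrightarrow> X_seq n p i = (if i = n - 1 then 1 else 0)"
  by (simp add: X_seq_def lin_rec.simps)

text \<open>Only b = n - 1 contributes; the range b < n - a then forces a = 0, where the coefficient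
  is 1.\<close>

lemma tri_form_X_seq_0:
  assumes "n \<ge> 1"
  shows "tri_form p n f (X_seq n p) = f 0"
proof -
  have "tri_form p n f (X_seq n p) = (\<Sum>a<n. if a = 0 then f 0 else 0)"
    unfolding tri_form_def
  proof (rule sum.cong)
    fix a assume "a \<in> {..<n}"
    then have "(\<Sum>b<n - a. rec_coeff p (n - 1 - a - b) * f a * X_seq n p b) =
        (\<Sum>b<n - a. if b = n - 1 then rec_coeff p (n - 1 - a - b) * f a else 0)"
      by (intro sum.cong) (auto simp: X_seq_initial)
    also have "\<dots> = (if a = 0 then f 0 else 0)"
      using assms \<open>a \<in> {..<n}\<close> by (auto simp: sum.delta)
    finally show "(\<Sum>b<n - a. rec_coeff p (n - 1 - a - b) * f a * X_seq n p b) =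
        (if a = 0 then f 0 else 0)" .
  qed simp
  then show ?thesis
    using assms by (simp add: sum.delta)
qed

lemma lin_recurrent_add:
  assumes "n \<ge> 1" and "lin_recurrent n p w"
  shows "w (k + m) = tri_form p n (\<lambda>a. w (k + a)) (\<lambda>b. X_seq n p (m + b))"
proof (induction m arbitrary: k)
  case 0
  show ?case
    using tri_form_X_seq_0[OF assms(1), of p "\<lambda>a. w (k + a)"] by simp
next
  case (Suc m)
  show ?case
    using Suc[of "Suc k"] tri_form_swap_shift[OF assms(2) lin_recurrent_X_seq, of k m] by simp
qed

section \<open>The doubling formulas\<close>

lemma eval_Sum_form [simp]: "eval_form xs (Sum_form m f) = (\<Sum>i<m. eval_form xs (f i))"
  by (induction m) simp_all

text \<open>The sum in \<open>even_form\<close>, as a function of size and sequence;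
  \<open>odd_form\<close> contains the same sum for size n - 1 and a shifted sequence.\<close>

definition half_sum :: "(nat \<Rightarrow> 'a::comm_ring_1) \<Rightarrow> nat \<Rightarrow> (nat \<Rightarrow> 'a) \<Rightarrow> 'a" where
  "half_sum p n x =
    (\<Sum>i<n div 2. x (n div 2 - 1 - i) *
      (2 * x ((n + 1) div 2 + i) - p (2 * i + n mod 2) * x (n div 2 - 1 - i) -
        2 * (\<Sum>j<2 * i + n mod 2. p j * x ((n + 1) div 2 - 1 + i - j))))"

text \<open>The summand with the largest i is the contribution of the border of the triangle;
  without it the sum of size n remains, read one place further on.\<close>

lemma half_sum_Suc_Suc:
  "half_sum p (Suc (Suc n)) x =
    x 0 * (2 * x (Suc n) - p n * x 0 - 2 * (\<Sum>j<n. p j * x (n - j))) + half_sum p n (\<lambda>i. x (Suc i))"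
proof -
  have n: "n div 2 * 2 + n mod 2 = n" "Suc n div 2 + n div 2 = n"
    by presburger+
  \<comment> \<open>The index bounds rule out truncated subtraction, so \<open>Suc\<close> can be
    moved through it.\<close>
  have "x (Suc ((n + 1) div 2 - 1 + i - j)) = x (Suc n div 2 + i - j)"
    if "i \<in> {..<n div 2}" "j \<in> {..<2 * i + n mod 2}" for i j
    by (rule arg_cong[of _ _ x]) (use that[unfolded lessThan_iff] in linarith)
  moreover have "x (Suc (n div 2 - 1 - i)) = x (n div 2 - i)" if "i \<in> {..<n div 2}" for i
    by (rule arg_cong[of _ _ x]) (use that[unfolded lessThan_iff] in linarith)
  moreover have "x (Suc ((n + 1) div 2 + i)) = x (Suc (Suc n div 2) + i)" for i
    by simp
  ultimately have "half_sum p n (\<lambda>i. x (Suc i)) =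
    (\<Sum>i<n div 2. x (n div 2 - i) *
      (2 * x (Suc (Suc n div 2) + i) - p (2 * i + n mod 2) * x (n div 2 - i) -
        2 * (\<Sum>j<2 * i + n mod 2. p j * x (Suc n div 2 + i - j))))"
    unfolding half_sum_def by (simp only: cong: sum.cong)
  moreover have "half_sum p (Suc (Suc n)) x =
    (\<Sum>i<Suc (n div 2). x (n div 2 - i) *
      (2 * x (Suc (Suc n div 2) + i) - p (2 * i + n mod 2) * x (n div 2 - i) -
        2 * (\<Sum>j<2 * i + n mod 2. p j * x (Suc n div 2 + i - j))))"
    by (simp add: half_sum_def)
  ultimately show ?thesis
    using n by (simp add: mult.commute[of 2])
qed

text \<open>Induction in steps of two: for size n + 2 the edges a = 0 and b = 0 share a corner with
  coefficient -p_n and otherwise agree, hence the factor 2. An odd size shrinks to one square in the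
  middle.\<close>

lemma tri_form_diag:
  "tri_form p n x x =
    (if n mod 2 = 1 then (x ((n - 1) div 2))\<^sup>2 else 0) + half_sum p n x"
proof (induction n arbitrary: x rule: induct_nat_012)
  case 0
  then show ?case by (simp add: half_sum_def)
next
  case 1
  then show ?case by (simp add: half_sum_def tri_form_def power2_eq_square)
next
  case (ge2 n)
  have inner: "(\<Sum>a\<le>n. rec_coeff p (n - a) * x (Suc a)) = x (Suc n) - (\<Sum>j<n. p j * x (n - j))"
    by (subst sum_rec_coeff) (auto intro!: sum.cong simp: Suc_diff_Suc)
  have outer: "(\<Sum>a\<le>Suc n. rec_coeff p (Suc n - a) * x a) =
      - p n * x 0 + (\<Sum>a\<le>n. rec_coeff p (n - a) * x (Suc a))"
    by (subst sum.atMost_Suc_shift) simp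
  have "tri_form p (Suc (Suc n)) x x =
      x 0 * (- p n * x 0 + (x (Suc n) - (\<Sum>j<n. p j * x (n - j)))) +
      (x 0 * (x (Suc n) - (\<Sum>j<n. p j * x (n - j))) +
       tri_form p n (\<lambda>a. x (Suc a)) (\<lambda>a. x (Suc a)))"
    by (simp only: tri_form_Suc[of p "Suc n"] tri_form_Suc'[of p n "\<lambda>a. x (Suc a)"] outer inner)
  moreover have "x (Suc ((n - 1) div 2)) = x ((Suc (Suc n) - 1) div 2)" if "n mod 2 = 1"
  proof -
    have "Suc ((n - 1) div 2) = (Suc (Suc n) - 1) div 2"
      using that by linarith
    then show ?thesis by (rule arg_cong)
  qed
  ultimately show ?case
    by (simp add: ge2 half_sum_Suc_Suc algebra_simps)
qed

definition window :: "(nat \<Rightarrow> 'a) \<Rightarrow> nat \<Rightarrow> nat \<Rightarrow> 'a list" where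
  "window w n k = map (\<lambda>d. w (k + d)) [0..<n]"

lemma window_nth [simp]: "d < n \<Longrightarrow> window w n k ! d = w (k + d)"
  by (simp add: window_def)

lemma eval_even_form:
  assumes "n \<ge> 1"
  shows "eval_form (window w n k) (even_form n p) = tri_form p n (\<lambda>d. w (k + d)) (\<lambda>d. w (k + d))"
proof -
  have bounds: "n div 2 - 1 - i < n" "(n + 1) div 2 + i < n" "(n + 1) div 2 - 1 + i - j < n"
    if "i < n div 2" for i j
    using that by linarith+
  have "(n - 1) div 2 < n"
    using assms by presburger
  then show ?thesis
    unfolding even_form_def tri_form_diag half_sum_def Let_def
    by (auto simp: bounds intro!: sum.cong)
qed

text \<open>For n = l + 1 the parities of n and l are opposite, so the sum and the optional square
  of \<open>odd_form\<close> are those of \<open>even_form\<close> for size l, read from k +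
  1.\<close>

lemma eval_odd_form:
  assumes "n \<ge> 1"
  shows "eval_form (window w n k) (odd_form n p) =
    p (n - 1) * (w k)\<^sup>2 + tri_form p (n - 1) (\<lambda>d. w (Suc k + d)) (\<lambda>d. w (Suc k + d))"
proof -
  obtain l where n: "n = Suc l"
    using assms by (cases n) auto
  have par: "Suc l mod 2 = 1 - l mod 2" "Suc l mod 2 = 0 \<longleftrightarrow> l mod 2 = 1"
    "Suc (Suc l) div 2 - 1 = l div 2"
    by presburger+
  have two: "2 * i + 1 - (1 - l mod 2) = 2 * i + l mod 2" for i
    by presburger
  have idx: "l div 2 - i < Suc l" "Suc l div 2 + 1 + i < Suc l" "Suc l div 2 + i - j < Suc l"
    if "i < l div 2" for i j
    using that by linarith+
  have w: "w (Suc k + (l div 2 - 1 - i)) = w (k + (l div 2 - i))"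
    "w (Suc k + ((l + 1) div 2 + i)) = w (k + (Suc l div 2 + 1 + i))" if "i \<in> {..<l div 2}" for i
    by (rule arg_cong[of _ _ w], use that[unfolded lessThan_iff] in linarith)+
  have w': "w (Suc k + ((l + 1) div 2 - 1 + i - j)) = w (k + (Suc l div 2 + i - j))"
    if "i \<in> {..<l div 2}" "j \<in> {..<2 * i + l mod 2}" for i j
    by (rule arg_cong[of _ _ w]) (use that[unfolded lessThan_iff] in linarith)
  have sq: "w (Suc (k + (l - 1) div 2)) = w (k + Suc l div 2)" if "l mod 2 = 1"
  proof -
    have "Suc ((l - 1) div 2) = Suc l div 2"
      using that by linarith
    then show ?thesis by (metis add_Suc_right)
  qed
  have "Suc l div 2 < Suc l"
    by simp
  then have "eval_form (window w n k) (odd_form n p) =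
    p l * (w k)\<^sup>2 + (if l mod 2 = 1 then (w (k + Suc l div 2))\<^sup>2 else 0) +
    (\<Sum>i<l div 2. w (k + (l div 2 - i)) *
      (2 * w (k + (Suc l div 2 + 1 + i)) - p (2 * i + l mod 2) * w (k + (l div 2 - i)) -
        2 * (\<Sum>j<2 * i + l mod 2. p j * w (k + (Suc l div 2 + i - j)))))"
    unfolding odd_form_def Let_def n
    by (simp add: par two idx del: mod_Suc_eq)
  moreover have "half_sum p l (\<lambda>d. w (Suc k + d)) =
    (\<Sum>i<l div 2. w (k + (l div 2 - i)) *
      (2 * w (k + (Suc l div 2 + 1 + i)) - p (2 * i + l mod 2) * w (k + (l div 2 - i)) -
        2 * (\<Sum>j<2 * i + l mod 2. p j * w (k + (Suc l div 2 + i - j)))))"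
    unfolding half_sum_def by (simp only: w w' cong: sum.cong)
  ultimately show ?thesis
    using sq by (simp add: n tri_form_diag)
qed

lemma X_seq_double:
  assumes "n \<ge> 1"
  shows "eval_form (window (X_seq n p) n k) (even_form n p) = X_seq n p (2 * k)"
  using lin_recurrent_add[OF assms lin_recurrent_X_seq, of p k k]
  by (simp add: eval_even_form[OF assms] mult_2)

lemma X_seq_double_Suc:
  assumes "n \<ge> 1"
  shows "eval_form (window (X_seq n p) n k) (odd_form n p) = X_seq n p (Suc (2 * k))"
proof -
  have "X_seq n p (Suc (2 * k)) = X_seq n p (k + Suc k)"
    by (simp add: mult_2)
  also have "\<dots> = tri_form p n (\<lambda>a. X_seq n p (k + a)) (\<lambda>b. X_seq n p (Suc k + b))"
    by (rule lin_recurrent_add[OF assms lin_recurrent_X_seq])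
  also have "\<dots> = p (n - 1) * X_seq n p k * X_seq n p k +
      tri_form p (n - 1) (\<lambda>a. X_seq n p (Suc k + a)) (\<lambda>b. X_seq n p (Suc k + b))"
    using tri_form_shift[of "n - 1" p "X_seq n p" "X_seq n p" k k] lin_recurrent_X_seq[of n p] assms
    by simp
  finally show ?thesis
    by (simp only: eval_odd_form[OF assms] power2_eq_square mult.assoc)
qed

section \<open>Substitution\<close>

text \<open>Lookup with \<open>!\<close> is meaningful only below the length of the list; recording
  the positions used lets a substitution be justified just where a formula looks.\<close>

primrec offsets :: "'a form \<Rightarrow> nat set" where
  "offsets Zero = {}"
| "offsets (Term d) = {d}"
| "offsets (Plus s t) = offsets s \<union> offsets t"
| "offsets (Minus s t) = offsets s \<union> offsets t"
| "offsets (Scale c t) = offsets t"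
| "offsets (Square t) = offsets t"
| "offsets (Mult s t) = offsets s \<union> offsets t"

lemma offsets_Sum_form [simp]: "offsets (Sum_form m f) = (\<Union>i<m. offsets (f i))"
  by (induction m) (auto simp: less_Suc_eq)

lemma offsets_subst_form: "offsets (subst_form \<sigma> t) = (\<Union>d\<in>offsets t. offsets (\<sigma> d))"
  by (induction t) auto

lemma eval_subst_form:
  "(\<And>d. d \<in> offsets t \<Longrightarrow> eval_form xs (\<sigma> d) = ys ! d) \<Longrightarrow>
    eval_form xs (subst_form \<sigma> t) = eval_form ys t"
  by (induction t) auto

lemma mults_Sum_form [simp]: "mults (Sum_form m f) = (\<Sum>i<m. mults (f i))"
  by (induction m) simp_all

lemma mults_subst_form: "(\<And>d. mults (\<sigma> d) = 0) \<Longrightarrow> mults (subst_form \<sigma> t) = mults t"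
  by (induction t) auto

lemma offsets_even_form: "n \<ge> 1 \<Longrightarrow> offsets (even_form n p) \<subseteq> {..<n}"
  unfolding even_form_def Let_def by auto

lemma offsets_odd_form: "n \<ge> 1 \<Longrightarrow> offsets (odd_form n p) \<subseteq> {..<n}"
  unfolding odd_form_def Let_def by auto

lemma offsets_trans_form: "n \<ge> 1 \<Longrightarrow> offsets (trans_form n p i) \<subseteq> {..<n}"
proof (induction i rule: induct_nat_012)
  case (ge2 i)
  then show ?case
    by (auto simp: offsets_subst_form shift_term_def split: if_splits)
qed (simp_all add: offsets_even_form offsets_odd_form)

lemma eval_shift_term:
  assumes "d < n" and "lin_recurrent n p w"
  shows "eval_form (window w n k) (shift_term n p d) = w (Suc k + d)"
proof (cases "d + 1 < n")
  case False
  then have "Suc k + d = k + n"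
    using assms(1) by simp
  moreover have "w (k + n) = (\<Sum>i<n. p i * w (k + (n - 1 - i)))"
    using assms(2) by (auto simp: lin_recurrent_def intro!: sum.cong)
  moreover have "eval_form (window w n k) (shift_term n p d) = (\<Sum>i<n. p i * w (k + (n - 1 - i)))"
    using False by (simp add: shift_term_def)
  ultimately show ?thesis
    by metis
qed (simp add: shift_term_def)

text \<open>Substituting \<open>shift_term\<close> turns lookup at k into lookup at k + 1, so the
  induction hypothesis is needed at \<open>Suc k\<close>.\<close>

lemma eval_trans_form:
  assumes "n \<ge> 1"
  shows "eval_form (window (X_seq n p) n k) (trans_form n p i) = X_seq n p (2 * k + i)"
proof (induction i arbitrary: k rule: induct_nat_012)
  case (ge2 i)
  have "eval_form (window (X_seq n p) n k) (trans_form n p (Suc (Suc i))) =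
      eval_form (window (X_seq n p) n (Suc k)) (trans_form n p i)"
    unfolding trans_form.simps
  proof (rule eval_subst_form)
    fix d assume "d \<in> offsets (trans_form n p i)"
    then have "d < n"
      using offsets_trans_form[OF assms] by blast
    then show "eval_form (window (X_seq n p) n k) (shift_term n p d) = window (X_seq n p) n (Suc k) ! d"
      by (simp add: eval_shift_term lin_recurrent_X_seq)
  qed
  then show ?case
    by (simp add: ge2)
qed (simp_all add: X_seq_double[OF assms] X_seq_double_Suc[OF assms])

section \<open>Counting multiplications\<close>

lemma mults_even_form: "mults (even_form n p) = (n + 1) div 2"
  unfolding even_form_def Let_def by simp presburger

lemma mults_odd_form: "n \<ge> 1 \<Longrightarrow> mults (odd_form n p) = n div 2 + 1"
  unfolding odd_form_def Let_def by simp presburger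

lemma mults_trans_form:
  assumes "n \<ge> 1"
  shows "mults (trans_form n p i) = (if even i then (n + 1) div 2 else n div 2 + 1)"
proof (induction i rule: induct_nat_012)
  case (ge2 i)
  have "mults (shift_term n p d) = 0" for d
    by (simp add: shift_term_def)
  then show ?case
    using ge2 by (simp add: mults_subst_form)
qed (simp_all add: mults_even_form mults_odd_form[OF assms])

text \<open>For odd n every formula costs (n + 1) / 2. For even n the costs n / 2 and n / 2 + 1
  alternate, and each occurs n / 2 times whichever digit is read.\<close>

lemma mults_transition:
  assumes "n \<ge> 1"
  shows "2 * sum_list (map mults (transition n p b)) = n * (n + 1)"
proof -
  \<comment> \<open>The number m of formulas is separated from n, so that induction over pairs of
    formulas keeps the costs fixed.\<close>
  have *: "2 * (\<Sum>i<m. if even (i + of_bool b) then (n + 1) div 2 else n div 2 + 1) = m * (n + 1)"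
    if "odd n \<or> even m" for m
  proof (cases "odd n")
    case True
    then have c: "(n + 1) div 2 = n div 2 + 1" "2 * (n div 2 + 1) = n + 1"
      by presburger+
    show ?thesis
      by (simp only: c if_cancel sum_constant card_lessThan of_nat_id mult.left_commute[of 2])
  next
    case False
    then have "even m" and c: "(n + 1) div 2 = n div 2" "2 * (n div 2) = n"
      using that by auto
    from \<open>even m\<close> obtain h where "m = 2 * h" by blast
    moreover have "2 * (\<Sum>i<2 * h. if even (i + of_bool b) then n div 2 else n div 2 + 1) =
        2 * h * (n + 1)"
      using c(2) by (induction h) (auto simp: algebra_simps)
    ultimately show ?thesis by (simp only: c(1))
  qed
  have "sum_list (map mults (transition n p b)) = (\<Sum>i<n. mults (trans_form n p (i + of_bool b)))"
    by (simp add: transition_def comp_def interv_sum_list_conv_sum_set_nat atLeast0LessThan)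
  then show ?thesis
    using *[of n] by (simp add: mults_trans_form[OF assms])
qed

section \<open>The loop\<close>

lemma eval_transition:
  assumes "n \<ge> 1"
  shows "map (eval_form (window (X_seq n p) n k)) (transition n p b) =
    window (X_seq n p) n (2 * k + of_bool b)"
  unfolding transition_def map_map comp_def eval_trans_form[OF assms]
  by (simp add: window_def add_ac)

text \<open>Loop invariant: while M digits are still unread, the current index is the binary prefix
  \<open>N div 2 ^ M\<close>.\<close>

lemma foldl_scheme_step:
  assumes "n \<ge> 1"
  shows "foldl (\<lambda>s j. scheme_step n p (bit N j) s)
      (window (X_seq n p) n (N div 2 ^ M), c) (rev [0..<M]) =
    (window (X_seq n p) n N, c + M * (n * (n + 1) div 2))"
proof (induction M arbitrary: c)
  case (Suc M)
  have "2 * (N div 2 ^ Suc M) + of_bool (bit N M) = N div 2 ^ M"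
    by (simp add: bit_iff_odd div_mult2_eq mult.commute[of 2] flip: mod_2_eq_odd)
  moreover have "sum_list (map mults (transition n p (bit N M))) = n * (n + 1) div 2"
    using mults_transition[OF assms, of p "bit N M"] by linarith
  ultimately have "scheme_step n p (bit N M) (window (X_seq n p) n (N div 2 ^ Suc M), c) =
      (window (X_seq n p) n (N div 2 ^ M), c + n * (n + 1) div 2)"
    by (simp only: scheme_step_def fst_conv snd_conv eval_transition[OF assms])
  then show ?case
    by (simp add: Suc del: power_Suc)
qed simp

text \<open>The exponents have the shape that \<open>floor_log_nat_eq_if\<close> expects; N \<ge> 1
  excludes zero digits, so the subtraction does not truncate.\<close>

lemma num_digits_bounds:
  assumes "N \<ge> 1"
  shows "2 ^ (num_digits N - 1) \<le> N" and "N < 2 ^ (num_digits N - 1 + 1)"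
proof -
  have less: "N < 2 ^ num_digits N"
    unfolding num_digits_def by (rule LeastI[of _ N]) simp
  then have "num_digits N \<noteq> 0"
    using assms by (cases "num_digits N") auto
  then show "N < 2 ^ (num_digits N - 1 + 1)"
    using less by simp
  have "\<not> N < 2 ^ (num_digits N - 1)"
    using \<open>num_digits N \<noteq> 0\<close> unfolding num_digits_def by (intro not_less_Least) simp
  then show "2 ^ (num_digits N - 1) \<le> N"
    by simp
qed

lemma scheme_loop_eq:
  assumes "n \<ge> 1" and "N \<ge> 1"
  shows "scheme_loop n p N =
    (window (X_seq n p) n N, (num_digits N - 1) * (n * (n + 1) div 2))"
proof -
  \<comment> \<open>The leading digit is 1, so the initial list belongs to the prefix consisting of
    that digit alone.\<close>
  have "N div 2 ^ (num_digits N - 1) = 1"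
    using num_digits_bounds[OF assms(2)] by (intro div_nat_eqI) simp_all
  moreover have "map (X_seq n p) [1..<n + 1] = window (X_seq n p) n 1"
    by (intro nth_equalityI) (simp_all add: window_def del: upt_Suc)
  ultimately show ?thesis
    using foldl_scheme_step[OF assms(1), of p N "num_digits N - 1" 0]
    by (simp add: scheme_loop_def)
qed

lemma eval_final_form:
  assumes "n \<ge> 1"
  shows "eval_form (window (X_seq n p) n N) (final_form n a p) = lin_rec n a p N"
proof -
  \<comment> \<open>The row sums of the triangle see only initial values, because b < n, and are the
    coefficients in \<open>final_form\<close>.\<close>
  have "(\<Sum>b<n - j. rec_coeff p (n - 1 - j - b) * lin_rec n a p b) =
      a (n - 1 - j) - (\<Sum>i<n - j - 1. a (n - j - 2 - i) * p i)" if "j < n" for j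
  proof -
    have "(\<Sum>b<n - j. rec_coeff p (n - 1 - j - b) * lin_rec n a p b) =
        (\<Sum>b\<le>n - 1 - j. rec_coeff p (n - 1 - j - b) * a b)"
      using that by (intro sum.cong) (auto simp: lin_rec.simps)
    also have "\<dots> = a (n - 1 - j) - (\<Sum>i<n - 1 - j. p i * a (n - 1 - j - 1 - i))"
      by (rule sum_rec_coeff)
    also have "\<dots> = a (n - 1 - j) - (\<Sum>i<n - j - 1. a (n - j - 2 - i) * p i)"
      by (simp add: mult.commute)
    finally show ?thesis .
  qed
  moreover have "tri_form p n (\<lambda>b. X_seq n p (N + b)) (lin_rec n a p) =
      (\<Sum>j<n. (\<Sum>b<n - j. rec_coeff p (n - 1 - j - b) * lin_rec n a p b) * X_seq n p (N + j))"
    by (simp add: tri_form_def sum_distrib_left sum_distrib_right mult_ac)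
  ultimately have "tri_form p n (\<lambda>b. X_seq n p (N + b)) (lin_rec n a p) =
      (\<Sum>j<n. (a (n - 1 - j) - (\<Sum>i<n - j - 1. a (n - j - 2 - i) * p i)) * X_seq n p (N + j))"
    by simp
  then show ?thesis
    using lin_recurrent_add[OF assms lin_recurrent_lin_rec, of a p 0 N]
    by (simp add: final_form_def tri_form_commute[of p n "lin_rec n a p"])
qed

theorem mainTheorem4:
  fixes n N :: nat and a p :: "nat \<Rightarrow> 'a::comm_ring_1"
  assumes "n \<ge> 1" and "N \<ge> 1"
  shows "fst (scheme n a p N) = lin_rec n a p N \<and>
    real (snd (scheme n a p N)) = real n * (real n + 1) / 2 * real_of_int \<lfloor>log 2 (real N)\<rfloor> \<and>
    real (snd (scheme n a p N)) \<le> real n * (real n + 1) / 2 * log 2 (real N)"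
proof -
  have result: "fst (scheme n a p N) = lin_rec n a p N"
    by (simp add: scheme_def scheme_loop_eq[OF assms] eval_final_form[OF assms(1)])
  have "\<lfloor>log 2 (real N)\<rfloor> = int (num_digits N - 1)"
    using floor_log_nat_eq_if[OF num_digits_bounds[OF assms(2)]] by simp
  moreover have "real (n * (n + 1) div 2) = real n * (real n + 1) / 2"
    by (simp add: real_of_nat_div field_simps)
  ultimately have count: "real (snd (scheme n a p N)) =
      real n * (real n + 1) / 2 * real_of_int \<lfloor>log 2 (real N)\<rfloor>"
    by (simp add: scheme_def scheme_loop_eq[OF assms] final_form_def)
  also have "\<dots> \<le> real n * (real n + 1) / 2 * log 2 (real N)"
    by (intro mult_left_mono) simp_all
  finally show ?thesis
    using result count by simp
qed

end
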